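(* Let $k$ be an infinite field of characteristic $p>2$. Then $L_2=L_3$.
   Context: Let $X=\{x_1,x_2,\ldots\}$ be a countably infinite set and let $k_0\langle X\rangle$ denote the free associative $k$-algebra (without identity) on $X$. A $T$-space of $k_0\langle X\rangle$ is a $k$-linear subspace closed under every algebra endomorphism of $k_0\langle X\rangle$; the $T$-space generated by a subset is the smallest $T$-space containing it. Let $L_1$ be the $T$-space generated by $x_1^p$, and for $n\ge1$ let $L_{n+1}$ be the $T$-space generated by $L_n$ together with all products $u\,v^p$ with $u\in L_n$, $v\in k_0\langle X\rangle$ (equivalently, by $L_n\cup L_n x_{n+1}^p$). Thus $L_n$ is the $T$-space generated by $x_1^p, x_1^px_2^p,\ldots,x_1^p\cdots x_n^p$. *)

theory Defs
  imports Main
begin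

text \<open>The free associative k-algebra without identity on countably many
variables x_0, x_1, x_2, ... (indexed by nat).  An element is represented by
its coefficient function on words (lists of variable indices): finitely
supported, and with coefficient 0 on the empty word (no identity).\<close>

type_synonym 'k ncpoly = "nat list \<Rightarrow> 'k"

definition freealg :: "('k::field) ncpoly set" where
  "freealg = {f. finite {w. f w \<noteq> 0} \<and> f [] = 0}"

definition ncvar :: "nat \<Rightarrow> ('k::field) ncpoly" where
  "ncvar i = (\<lambda>w. if w = [i] then 1 else 0)"

definition ncadd :: "('k::field) ncpoly \<Rightarrow> 'k ncpoly \<Rightarrow> 'k ncpoly" where
  "ncadd f g = (\<lambda>w. f w + g w)"

definition ncsmult :: "'k::field \<Rightarrow> 'k ncpoly \<Rightarrow> 'k ncpoly" where
  "ncsmult c f = (\<lambda>w. c * f w)"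

definition ncmul :: "('k::field) ncpoly \<Rightarrow> 'k ncpoly \<Rightarrow> 'k ncpoly" where
  "ncmul f g = (\<lambda>w. \<Sum>i\<le>length w. f (take i w) * g (drop i w))"

text \<open>Positive powers f^n, n >= 1 (ncpow f 0 is f^1 by convention; only
used with n >= 1).\<close>
primrec ncpow' :: "('k::field) ncpoly \<Rightarrow> nat \<Rightarrow> 'k ncpoly" where
  "ncpow' f 0 = f"
| "ncpow' f (Suc n) = ncmul (ncpow' f n) f"

definition ncpow :: "('k::field) ncpoly \<Rightarrow> nat \<Rightarrow> 'k ncpoly" where
  "ncpow f n = ncpow' f (n - 1)"

fun wordeval :: "(nat \<Rightarrow> ('k::field) ncpoly) \<Rightarrow> nat list \<Rightarrow> 'k ncpoly" where
  "wordeval s [] = (\<lambda>_. 0)"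
| "wordeval s [i] = s i"
| "wordeval s (i # j # w) = ncmul (s i) (wordeval s (j # w))"

text \<open>The algebra endomorphism of the free algebra determined by x_i |-> s i
(every endomorphism arises this way, by freeness).\<close>
definition ncsubst :: "(nat \<Rightarrow> ('k::field) ncpoly) \<Rightarrow> 'k ncpoly \<Rightarrow> 'k ncpoly" where
  "ncsubst s f = (\<lambda>v. \<Sum>w\<in>{w. f w \<noteq> 0}. f w * wordeval s w v)"

definition is_endo :: "(nat \<Rightarrow> ('k::field) ncpoly) \<Rightarrow> bool" where
  "is_endo s \<longleftrightarrow> (\<forall>i. s i \<in> freealg)"

definition Tspace :: "('k::field) ncpoly set \<Rightarrow> bool" where
  "Tspace V \<longleftrightarrow> V \<subseteq> freealg \<and> (\<lambda>_. 0) \<in> V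
     \<and> (\<forall>f\<in>V. \<forall>g\<in>V. ncadd f g \<in> V)
     \<and> (\<forall>c. \<forall>f\<in>V. ncsmult c f \<in> V)
     \<and> (\<forall>s. is_endo s \<longrightarrow> (\<forall>f\<in>V. ncsubst s f \<in> V))"

definition Tspan :: "('k::field) ncpoly set \<Rightarrow> 'k ncpoly set" where
  "Tspan S = \<Inter> {V. Tspace V \<and> S \<subseteq> V}"

fun Lsp :: "nat \<Rightarrow> nat \<Rightarrow> ('k::field) ncpoly set" where
  "Lsp p 0 = {}"
| "Lsp p (Suc 0) = Tspan {ncpow (ncvar 1) p}"
| "Lsp p (Suc (Suc n)) = Tspan (Lsp p (Suc n) \<union>
      {ncmul u (ncpow v p) | u v. u \<in> Lsp p (Suc n) \<and> v \<in> freealg})"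

end

theory Submission
  imports Defs "HOL-Computational_Algebra.Polynomial"
    "HOL-Computational_Algebra.Formal_Power_Series"
begin

text \<open>Write \<open>D x y = \<Sum>k<p. x ^ k y x ^ (p - 1 - k)\<close>.  As the coefficient of \<open>l\<close> in
  \<open>(x + l y) ^ p\<close> it lies in \<open>L1\<close>, and \<open>[y, x ^ p] = D x [y, x]\<close> telescopes, so \<open>[A, L1] \<subseteq> L1\<close> for
  the free algebra \<open>A\<close>.  Then \<open>[a, b] y = [a y, b] - a [y, b]\<close> gives \<open>[L1, L1] A \<subseteq> L2\<close>.  Modulo
  such elements \<open>D x (a b y) - a D x (b y) - b D x (a y) + a b D x y\<close> vanishes for \<open>a, b \<in> L1\<close>, hence
  \<open>a b D x y \<in> L2\<close>.  The derivative of \<open>(v + l u) ^ p\<close> with respect to \<open>l\<close> is \<open>D (v + l u) u\<close>, so the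
  \<open>p\<close>-th power is additive modulo elements \<open>r\<close> with \<open>a b r \<in> L2\<close>.  Expanding
  \<open>a (u + v) ^ p (u + v) ^ p = a ((u + v)\<^sup>2) ^ p \<in> L2\<close> now yields \<open>2 a u ^ p v ^ p \<in> L2\<close>, and 2 is
  invertible.\<close>

section \<open>Powers in algebras over an infinite field\<close>

text \<open>Each equation \<open>x ^ m = 1\<close> with \<open>0 < m\<close> has finitely many
  roots, so an infinite field has elements outside all of them. This supplies the separating scalar
  for the elimination in \<open>coefficients_in_subspace\<close>.\<close>

lemma infinite_field_ex_not_root_of_unity:
  assumes "infinite (UNIV :: 'k::field set)"
  obtains \<mu> :: "'k::field" where "\<mu> \<noteq> 0" "\<And>m. 0 < m \<Longrightarrow> m \<le> N \<Longrightarrow> \<mu> ^ m \<noteq> 1"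
proof -
  have "finite {x :: 'k. x ^ m = 1}" if "0 < m" for m
  proof -
    have "poly (monom 1 m - 1) 0 \<noteq> (0 :: 'k)"
      using that by (simp add: poly_monom zero_power)
    then have "monom 1 m - 1 \<noteq> (0 :: 'k poly)" by auto
    from poly_roots_finite[OF this] show ?thesis by (simp add: poly_monom)
  qed
  then have "finite (insert 0 (\<Union>m\<in>{1..N}. {x :: 'k. x ^ m = 1}))" by simp
  then obtain \<mu> :: 'k where "\<mu> \<notin> insert 0 (\<Union>m\<in>{1..N}. {x :: 'k. x ^ m = 1})"
    using assms ex_new_if_finite by blast
  then show thesis by (intro that[of \<mu>]) auto
qed

locale assoc_algebra = vector_space scale
  for scale :: "'k::field \<Rightarrow> 'a::ring_1 \<Rightarrow> 'a" (infixr \<open>*s\<close> 75) +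
  assumes scale_mult_left [simp]: "(c *s x) * y = c *s (x * y)"
    and mult_scale_right [simp]: "x * (c *s y) = c *s (x * y)"
begin

lemma subspace_preimage_mult:
  assumes "subspace V"
  shows "subspace {x. y * x * z \<in> V}"
  using assms by (auto simp: subspace_def ring_distribs)

lemma subspace_preimage_commutator:
  assumes "subspace V"
  shows "subspace {x. y * x - x * y \<in> V}"
proof (rule subspaceI, goal_cases)
  case (2 x x')
  have "y * (x + x') - (x + x') * y = (y * x - x * y) + (y * x' - x' * y)"
    by (simp add: algebra_simps)
  with 2 show ?case using assms by (auto intro: subspace_add)
next
  case (3 c x)
  have "y * (c *s x) - (c *s x) * y = c *s (y * x - x * y)"
    by (simp add: algebra_simps)
  with 3 show ?case using assms by (auto intro: subspace_scale)
qed (use assms in \<open>auto simp: subspace_def\<close>)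

text \<open>A Vandermonde argument: a polynomial in \<open>l\<close> with vector coefficients whose
  values all lie in \<open>V\<close> has its coefficients in \<open>V\<close>. The infinitude of the
  field enters here.\<close>

lemma coefficients_in_subspace:
  assumes "infinite (UNIV :: 'k set)" "subspace V"
    and "\<And>l. (\<Sum>i\<le>N. l ^ i *s c i) \<in> V" and "i \<le> N"
  shows "c i \<in> V"
  using assms(3,4)
proof (induction N arbitrary: c i)
  case 0
  then show ?case using "0.prems"(1)[of 1] by simp
next
  case (Suc N)
  obtain \<mu> :: 'k where \<mu>: "\<mu> \<noteq> 0" "\<And>m. 0 < m \<Longrightarrow> m \<le> Suc N \<Longrightarrow> \<mu> ^ m \<noteq> 1"
    using infinite_field_ex_not_root_of_unity[OF assms(1)] by blast
  \<comment> \<open>Comparing the values at \<open>\<mu> l\<close> and at \<open>l\<close> eliminates the leading coefficient.\<close>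
  have "(\<Sum>i\<le>N. l ^ i *s ((\<mu> ^ i - \<mu> ^ Suc N) *s c i)) \<in> V" for l
  proof -
    have "(\<Sum>i\<le>N. l ^ i *s ((\<mu> ^ i - \<mu> ^ Suc N) *s c i)) =
        (\<Sum>i\<le>Suc N. l ^ i *s ((\<mu> ^ i - \<mu> ^ Suc N) *s c i))"
      by simp
    also have "\<dots> = (\<Sum>i\<le>Suc N. (\<mu> * l) ^ i *s c i) - \<mu> ^ Suc N *s (\<Sum>i\<le>Suc N. l ^ i *s c i)"
      by (simp only: scale_sum_right sum_subtractf[symmetric])
        (rule sum.cong, simp_all add: power_mult_distrib algebra_simps)
    also have "\<dots> \<in> V"
      by (intro subspace_diff[OF assms(2)] subspace_scale[OF assms(2)] Suc.prems(1))
    finally show ?thesis .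
  qed
  note * = Suc.IH[OF this]
  have low: "c j \<in> V" if "j \<le> N" for j
  proof -
    have "\<mu> ^ (Suc N - j) \<noteq> 1" using \<mu>(2) that by simp
    moreover have "\<mu> ^ Suc N = \<mu> ^ j * \<mu> ^ (Suc N - j)"
      using that by (simp add: power_add[symmetric] del: power_Suc)
    ultimately have "\<mu> ^ j - \<mu> ^ Suc N \<noteq> 0" using \<mu>(1)
      by (simp del: power_Suc)
    then have "c j = inverse (\<mu> ^ j - \<mu> ^ Suc N) *s ((\<mu> ^ j - \<mu> ^ Suc N) *s c j)"
      by (simp del: power_Suc)
    then show ?thesis using *[OF that] assms(2) by (metis subspace_scale)
  qed
  \<comment> \<open>The eliminated leading coefficient is recovered from the value at
    \<open>l = 1\<close>.\<close>
  have "c (Suc N) = (\<Sum>i\<le>Suc N. 1 ^ i *s c i) - (\<Sum>i\<le>N. c i)" by simp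
  also have "\<dots> \<in> V"
    by (rule subspace_diff[OF assms(2) Suc.prems(1)[of 1] subspace_sum[OF assms(2) low]]) simp
  finally show ?case using low Suc.prems(2) by (cases "i = Suc N") auto
qed

end

text \<open>The derivative of the \<open>n\<close>-th power at \<open>x\<close> in direction
  \<open>y\<close>, given by the Leibniz rule; for \<open>n = p\<close> it is the
  \<open>D x y\<close> of the overview.\<close>

primrec power_deriv :: "'a::ring_1 \<Rightarrow> 'a \<Rightarrow> nat \<Rightarrow> 'a" where
  "power_deriv x y 0 = 0"
| "power_deriv x y (Suc n) = power_deriv x y n * x + x ^ n * y"

text \<open>\<open>power_coeff u v n i\<close> is the coefficient of \<open>l ^ i\<close> in \<open>(v + l u) ^ n\<close>, and
  \<open>power_deriv_coeff u v n i\<close> the one in \<open>power_deriv (v + l u) u n\<close>, for a central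
  indeterminate \<open>l\<close>.\<close>

primrec power_coeff :: "'a::ring_1 \<Rightarrow> 'a \<Rightarrow> nat \<Rightarrow> nat \<Rightarrow> 'a" where
  "power_coeff u v 0 i = (if i = 0 then 1 else 0)"
| "power_coeff u v (Suc n) i =
    power_coeff u v n i * v + (case i of 0 \<Rightarrow> 0 | Suc j \<Rightarrow> power_coeff u v n j * u)"

primrec power_deriv_coeff :: "'a::ring_1 \<Rightarrow> 'a \<Rightarrow> nat \<Rightarrow> nat \<Rightarrow> 'a" where
  "power_deriv_coeff u v 0 i = 0"
| "power_deriv_coeff u v (Suc n) i = power_deriv_coeff u v n i * v +
    (case i of 0 \<Rightarrow> 0 | Suc j \<Rightarrow> power_deriv_coeff u v n j * u) + power_coeff u v n i * u"

lemma power_coeff_eq_0: "n < i \<Longrightarrow> power_coeff u v n i = 0"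
  by (induction n arbitrary: i) (auto split: nat.splits)

lemma power_deriv_coeff_eq_0: "n \<le> i \<Longrightarrow> power_deriv_coeff u v n i = 0"
  by (induction n arbitrary: i) (auto split: nat.splits simp: power_coeff_eq_0)

lemma power_coeff_0: "power_coeff u v n 0 = v ^ n"
  by (induction n) (auto simp: power_commutes)

lemma power_coeff_self: "power_coeff u v n n = u ^ n"
  by (induction n) (auto simp: power_commutes power_coeff_eq_0)

lemma power_coeff_1: "power_coeff u v n (Suc 0) = power_deriv v u n"
  by (induction n) (auto simp: power_coeff_0)

text \<open>The summands \<open>x ^ k * y * x ^ (n - k) - x ^ (k + 1) * y * x ^ (n - 1 - k)\<close>
  telescope.\<close>

lemma power_deriv_commutator: "power_deriv x (y * x - x * y) n = y * x ^ n - x ^ n * y"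
proof (induction n)
  case (Suc n)
  have "x ^ n * (x * y) = x * (x ^ n * y)" by (metis mult.assoc power_commutes)
  then show ?case
    unfolding power_deriv.simps Suc.IH by (simp add: algebra_simps power_commutes)
qed simp

text \<open>Coefficientwise form of the chain rule: the derivative of \<open>(v + l u) ^ n\<close>
  in \<open>l\<close> is the directional derivative at \<open>v + l u\<close> along
  \<open>u\<close>.\<close>

lemma power_coeff_deriv:
  "of_nat (Suc i) * power_coeff u v n (Suc i) = power_deriv_coeff u v n i"
proof (induction n arbitrary: i)
  case (Suc n)
  show ?case
  proof (cases i)
    case 0
    then show ?thesis using Suc[of 0] by simp
  next
    case (Suc j)
    have "of_nat (Suc i) * power_coeff u v (Suc n) (Suc i) =
        of_nat (Suc i) * power_coeff u v n (Suc i) * v +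
        of_nat (Suc j) * power_coeff u v n (Suc j) * u + power_coeff u v n i * u"
      by (simp add: Suc algebra_simps)
    also have "\<dots> = power_deriv_coeff u v (Suc n) i"
      unfolding Suc.IH by (simp add: Suc)
    finally show ?thesis .
  qed
qed simp

context assoc_algebra
begin

lemma scale_of_nat: "of_nat n *s x = of_nat n * x"
  by (induction n) (auto simp: algebra_simps)

lemma sum_power_coeff: "(v + l *s u) ^ n = (\<Sum>i\<le>n. l ^ i *s power_coeff u v n i)"
proof (induction n)
  case (Suc n)
  have "(v + l *s u) ^ Suc n = (v + l *s u) ^ n * (v + l *s u)"
    by (simp add: power_commutes)
  also have "\<dots> = (\<Sum>i\<le>n. l ^ i *s (power_coeff u v n i * v)) +
      (\<Sum>i\<le>n. l ^ Suc i *s (power_coeff u v n i * u))"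
    unfolding Suc.IH
    by (simp add: ring_distribs sum_distrib_right scale_sum_right mult.commute)
  also have "(\<Sum>i\<le>n. l ^ i *s (power_coeff u v n i * v)) =
      (\<Sum>i\<le>Suc n. l ^ i *s (power_coeff u v n i * v))"
    by (simp add: power_coeff_eq_0)
  also have "(\<Sum>i\<le>n. l ^ Suc i *s (power_coeff u v n i * u)) =
      (\<Sum>i\<le>Suc n. l ^ i *s (case i of 0 \<Rightarrow> 0 | Suc j \<Rightarrow> power_coeff u v n j * u))"
    by (simp only: sum.atMost_Suc_shift nat.case) simp
  finally show ?case
    by (simp only: sum.distrib[symmetric] scale_right_distrib[symmetric] power_coeff.simps)
qed simp

lemma sum_power_deriv_coeff:
  "power_deriv (v + l *s u) u n = (\<Sum>i\<le>n. l ^ i *s power_deriv_coeff u v n i)"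
proof (induction n)
  case (Suc n)
  have "power_deriv (v + l *s u) u (Suc n) =
      (\<Sum>i\<le>n. l ^ i *s (power_deriv_coeff u v n i * v)) +
      (\<Sum>i\<le>n. l ^ Suc i *s (power_deriv_coeff u v n i * u)) +
      (\<Sum>i\<le>n. l ^ i *s (power_coeff u v n i * u))"
    unfolding power_deriv.simps Suc.IH sum_power_coeff
    by (simp add: ring_distribs sum_distrib_right scale_sum_right mult.commute)
  also have "(\<Sum>i\<le>n. l ^ i *s (power_deriv_coeff u v n i * v)) =
      (\<Sum>i\<le>Suc n. l ^ i *s (power_deriv_coeff u v n i * v))"
    by (simp add: power_deriv_coeff_eq_0)
  also have "(\<Sum>i\<le>n. l ^ i *s (power_coeff u v n i * u)) =
      (\<Sum>i\<le>Suc n. l ^ i *s (power_coeff u v n i * u))"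
    by (simp add: power_coeff_eq_0)
  also have "(\<Sum>i\<le>n. l ^ Suc i *s (power_deriv_coeff u v n i * u)) =
      (\<Sum>i\<le>Suc n. l ^ i *s (case i of 0 \<Rightarrow> 0 | Suc j \<Rightarrow> power_deriv_coeff u v n j * u))"
    by (simp only: sum.atMost_Suc_shift nat.case) simp
  finally show ?case
    by (simp only: sum.distrib[symmetric] scale_right_distrib[symmetric] power_deriv_coeff.simps)
qed simp

end

section \<open>The spaces generated by products of powers\<close>

text \<open>\<open>A\<close> models the algebra without identity inside a unital ring, where
  \<open>x ^ 0\<close> makes sense. The characteristic enters as permission to divide by the
  integers from 1 to \<open>p - 1\<close>.\<close>

locale power_spaces = assoc_algebra scale
  for scale :: "'k::field \<Rightarrow> 'a::ring_1 \<Rightarrow> 'a" (infixr \<open>*s\<close> 75) +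
  fixes A :: "'a set" and p :: nat
  assumes infinite_scalars: "infinite (UNIV :: 'k set)"
    and subspace_A: "subspace A"
    and mult_A: "\<lbrakk>x \<in> A; y \<in> A\<rbrakk> \<Longrightarrow> x * y \<in> A"
    and p_gt_2: "2 < p"
    and of_nat_neq_0: "\<lbrakk>0 < i; i < p\<rbrakk> \<Longrightarrow> of_nat i \<noteq> (0 :: 'k)"
begin

text \<open>Linear spans of all values stand in for T-spaces, since no substitutions exist in this
  abstract setting; \<open>Lsp_1\<close> and \<open>Lsp_2\<close> show that they agree for the free
  algebra.\<close>

definition L1 :: "'a set" where
  "L1 = span ((\<lambda>v. v ^ p) ` A)"

definition L2 :: "'a set" where
  "L2 = span (L1 \<union> {u * v ^ p |u v. u \<in> L1 \<and> v \<in> A})"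

lemma power_A: "\<lbrakk>x \<in> A; 0 < m\<rbrakk> \<Longrightarrow> x ^ m \<in> A"
proof (induction m)
  case (Suc m)
  then show ?case by (cases "m = 0") (auto intro: mult_A)
qed simp

lemma subspace_L1: "subspace L1" and subspace_L2: "subspace L2"
  by (simp_all add: L1_def L2_def subspace_span)

lemma L1_subset_A: "L1 \<subseteq> A"
  unfolding L1_def using p_gt_2 by (intro span_minimal subspace_A) (auto intro: power_A)

lemma L1_subset_L2: "L1 \<subseteq> L2"
  unfolding L2_def by (meson Un_subset_iff span_superset)

lemma power_in_L1: "v \<in> A \<Longrightarrow> v ^ p \<in> L1"
  by (simp add: L1_def span_base)

lemma L1_induct [consumes 1, case_names subspace power]:
  assumes "b \<in> L1" "subspace {b. P b}" "\<And>v. v \<in> A \<Longrightarrow> P (v ^ p)"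
  shows "P b"
  using assms unfolding L1_def by (auto elim!: span_induct)

lemma L1_mult_L1:
  assumes a: "a \<in> L1" and b: "b \<in> L1"
  shows "a * b \<in> L2"
  using b
proof (induction rule: L1_induct)
  case subspace
  show ?case using subspace_preimage_mult[OF subspace_L2, of a 1] by simp
next
  case (power v)
  then show ?case using a unfolding L2_def by (blast intro: span_base)
qed

lemma power_deriv_in_L1:
  assumes "x \<in> A" "y \<in> A"
  shows "power_deriv x y p \<in> L1"
proof -
  have "(\<Sum>i\<le>p. l ^ i *s power_coeff y x p i) \<in> L1" for l
    unfolding sum_power_coeff[symmetric]
    using assms subspace_A by (intro power_in_L1) (simp add: subspace_add subspace_scale)
  from coefficients_in_subspace[OF infinite_scalars subspace_L1 this, of 1]
  show ?thesis using p_gt_2 by (simp add: power_coeff_1)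
qed

text \<open>By linearity \<open>b = x ^ p\<close> suffices, and then the commutator is the
  derivative of the \<open>p\<close>-th power at \<open>x\<close> along
  \<open>y * x - x * y\<close>.\<close>

lemma commutator_in_L1:
  assumes "y \<in> A" "b \<in> L1"
  shows "y * b - b * y \<in> L1"
  using assms(2)
proof (induction rule: L1_induct)
  case subspace
  show ?case by (rule subspace_preimage_commutator[OF subspace_L1])
next
  case (power x)
  have "power_deriv x (y * x - x * y) p \<in> L1"
    using power assms(1) subspace_A by (intro power_deriv_in_L1) (simp_all add: subspace_diff mult_A)
  then show ?case by (simp add: power_deriv_commutator)
qed

text \<open>In \<open>[a, b] y = [a y, b] - a [y, b]\<close> the first term lies in
  \<open>L1\<close> and the second is a product of two elements of \<open>L1\<close>.\<close>

lemma commutator_mult_in_L2: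
  assumes "a \<in> L1" "b \<in> L1" "y \<in> A"
  shows "(a * b - b * a) * y \<in> L2"
proof -
  have "(a * b - b * a) * y = ((a * y) * b - b * (a * y)) - a * (y * b - b * y)"
    by (simp add: algebra_simps)
  also have "\<dots> \<in> L2"
    using assms L1_subset_A L1_subset_L2
    by (intro subspace_diff[OF subspace_L2] L1_mult_L1 subsetD[OF L1_subset_L2] commutator_in_L1 mult_A) auto
  finally show ?thesis .
qed

text \<open>Since \<open>power_deriv x\<close> is \<open>\<Sum>k. x ^ k y x ^ (n - 1 - k)\<close>, the second-order difference below is
  \<open>\<Sum>k. ([[x ^ k, a], b] + [a, b] x ^ k) y x ^ (n - 1 - k)\<close>.\<close>

lemma power_deriv_difference_in_L2:
  assumes x: "x \<in> A" and y: "y \<in> A" and a: "a \<in> L1" and b: "b \<in> L1"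
  shows "(power_deriv x (a * b * y) n - a * power_deriv x (b * y) n - b * power_deriv x (a * y) n
    + a * b * power_deriv x y n) * x ^ m \<in> L2"
\<comment> \<open>The recursion for \<open>power_deriv\<close> multiplies by \<open>x\<close> on the
  right; the factor \<open>x ^ m\<close> absorbs this.\<close>
proof (induction n arbitrary: m)
  case (Suc n)
  have 1: "(a * b - b * a) * (x ^ n * y * x ^ m) \<in> L2"
  proof (rule commutator_mult_in_L2[OF a b])
    have "x ^ n * y \<in> A" using x y by (cases "n = 0") (auto intro: mult_A power_A)
    then show "x ^ n * y * x ^ m \<in> A" using x by (cases "m = 0") (auto intro: mult_A power_A)
  qed
  \<comment> \<open>For \<open>n > 0\<close> this commutator lies in \<open>L1\<close>, so
    \<open>[c, b]\<close> is again a commutator of elements of \<open>L1\<close>; for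
    \<open>n = 0\<close> it vanishes.\<close>
  define c where "c = x ^ n * a - a * x ^ n"
  have 2: "(c * b - b * c) * (y * x ^ m) \<in> L2"
  proof (cases "n = 0")
    case False
    then have "c \<in> L1" unfolding c_def using x a by (intro commutator_in_L1 power_A) auto
    moreover have "y * x ^ m \<in> A" using x y by (cases "m = 0") (auto intro: mult_A power_A)
    ultimately show ?thesis by (intro commutator_mult_in_L2 b)
  qed (simp add: c_def subspace_0[OF subspace_L2])
  have "(power_deriv x (a * b * y) (Suc n) - a * power_deriv x (b * y) (Suc n)
      - b * power_deriv x (a * y) (Suc n) + a * b * power_deriv x y (Suc n)) * x ^ m =
    (power_deriv x (a * b * y) n - a * power_deriv x (b * y) n - b * power_deriv x (a * y) n
      + a * b * power_deriv x y n) * x ^ Suc m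
    + (a * b - b * a) * (x ^ n * y * x ^ m) + (c * b - b * c) * (y * x ^ m)"
    by (simp add: c_def algebra_simps)
  also have "\<dots> \<in> L2"
    by (intro subspace_add[OF subspace_L2] Suc.IH 1 2)
  finally show ?case .
qed (simp add: subspace_0[OF subspace_L2])

text \<open>Three of the four terms of the second-order difference lie in \<open>L2\<close> on their
  own: one is in \<open>L1\<close>, two are products of elements of \<open>L1\<close>. Hence so does
  the fourth.\<close>

lemma L1_mult_L1_mult_power_deriv:
  assumes x: "x \<in> A" and y: "y \<in> A" and a: "a \<in> L1" and b: "b \<in> L1"
  shows "a * b * power_deriv x y p \<in> L2"
proof -
  have A: "a \<in> A" "b \<in> A" using a b L1_subset_A by auto
  let ?d = "power_deriv x (a * b * y) p - a * power_deriv x (b * y) p - b * power_deriv x (a * y) p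
    + a * b * power_deriv x y p"
  have "?d \<in> L2" using power_deriv_difference_in_L2[OF assms, of p 0] by simp
  moreover have "power_deriv x (a * b * y) p \<in> L2"
    using x y A by (intro subsetD[OF L1_subset_L2] power_deriv_in_L1 mult_A)
  moreover have "a * power_deriv x (b * y) p \<in> L2" "b * power_deriv x (a * y) p \<in> L2"
    using x y A a b by (auto intro!: L1_mult_L1 power_deriv_in_L1 mult_A)
  ultimately have "?d - (power_deriv x (a * b * y) p - a * power_deriv x (b * y) p
      - b * power_deriv x (a * y) p) \<in> L2"
    using subspace_diff[OF subspace_L2] by presburger
  then show ?thesis by (simp add: algebra_simps)
qed

lemma L1_mult_L1_mult_power_additivity:
  assumes u: "u \<in> A" and v: "v \<in> A" and a: "a \<in> L1" and b: "b \<in> L1"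
  shows "a * b * ((u + v) ^ p - u ^ p - v ^ p) \<in> L2"
proof -
  have "(\<Sum>i\<le>p. l ^ i *s (a * b * power_deriv_coeff u v p i)) \<in> L2" for l
  proof -
    have "v + l *s u \<in> A" using u v subspace_A by (simp add: subspace_add subspace_scale)
    from L1_mult_L1_mult_power_deriv[OF this u a b] show ?thesis
      by (simp add: sum_power_deriv_coeff sum_distrib_left)
  qed
  note * = coefficients_in_subspace[OF infinite_scalars subspace_L2 this]
  \<comment> \<open>Integrating in \<open>l\<close> divides by \<open>Suc i\<close>, which is
    invertible below \<open>p\<close>.\<close>
  have **: "a * b * power_coeff u v p (Suc i) \<in> L2" if "Suc i < p" for i
  proof -
    have "a * b * power_deriv_coeff u v p i =
        of_nat (Suc i) *s (a * b * power_coeff u v p (Suc i))"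
      by (simp only: power_coeff_deriv[symmetric] scale_of_nat[symmetric] mult_scale_right)
    then have "a * b * power_coeff u v p (Suc i) =
        inverse (of_nat (Suc i)) *s (a * b * power_deriv_coeff u v p i)"
      using of_nat_neq_0[OF _ that] by (simp del: of_nat_Suc)
    then show ?thesis using *[of i] that subspace_L2 by (simp add: subspace_scale)
  qed
  \<comment> \<open>Splitting off two from \<open>p\<close> separates the end coefficients
    \<open>v ^ p\<close> and \<open>u ^ p\<close> from the middle ones.\<close>
  obtain q where q: "p = Suc (Suc q)" using p_gt_2 by (metis Suc_1 less_imp_Suc_add add_Suc)
  have "(u + v) ^ p = (\<Sum>i\<le>p. power_coeff u v p i)"
    using sum_power_coeff[of v 1 u p] by (simp add: add.commute)
  also have "\<dots> = v ^ p + (\<Sum>i\<le>q. power_coeff u v p (Suc i)) + u ^ p"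
    unfolding q by (subst sum.atMost_Suc, subst sum.atMost_Suc_shift)
      (simp only: power_coeff_0 power_coeff_self)
  finally have "a * b * ((u + v) ^ p - u ^ p - v ^ p) = (\<Sum>i\<le>q. a * b * power_coeff u v p (Suc i))"
    by (simp add: sum_distrib_left)
  also have "\<dots> \<in> L2" using ** q by (intro subspace_sum[OF subspace_L2]) auto
  finally show ?thesis .
qed

lemma L1_mult_power_mult_power:
  assumes u: "u \<in> A" and v: "v \<in> A" and a: "a \<in> L1"
  shows "a * u ^ p * v ^ p \<in> L2"
proof -
  define w where "w = u + v"
  define l where "l = w ^ p - u ^ p - v ^ p"
  have w: "w \<in> A" unfolding w_def using u v subspace_A by (simp add: subspace_add)
  \<comment> \<open>Since \<open>z ^ p * z ^ p = (z * z) ^ p\<close>, this is a product of two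
    elements of \<open>L1\<close>.\<close>
  have square: "a * z ^ p * z ^ p \<in> L2" if "z \<in> A" for z
  proof -
    have "a * (z * z) ^ p \<in> L2"
      by (intro L1_mult_L1 a power_in_L1 mult_A that)
    then show ?thesis
      by (metis mult.assoc power2_eq_square power_even_eq power_mult mult.commute)
  qed
  have comm: "a * (y * b - b * y) \<in> L2" if "y \<in> A" "b \<in> L1" for y b
    by (intro L1_mult_L1 a commutator_in_L1 that)
  have add: "a * b * l \<in> L2" if "b \<in> L1" for b
    unfolding l_def w_def by (intro L1_mult_L1_mult_power_additivity a that u v)
  have pow: "u ^ p \<in> L1" "v ^ p \<in> L1" "w ^ p \<in> L1" "w ^ p \<in> A" "v ^ p \<in> A" "u ^ p \<in> A"
    using u v w power_in_L1 L1_subset_A by auto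
  have "l \<in> A" unfolding l_def by (intro subspace_diff[OF subspace_A] pow)
  \<comment> \<open>Expanding the left factor of \<open>w ^ p * w ^ p\<close> as
    \<open>u ^ p + v ^ p + l\<close> leaves a term \<open>a * l * w ^ p\<close> with the defect
    \<open>l\<close> in the wrong place; the commutator with \<open>w ^ p\<close> moves it to the
    right end, where \<open>add\<close> applies.\<close>
  have "a * w ^ p * w ^ p - a * u ^ p * u ^ p - a * v ^ p * v ^ p
      - a * (v ^ p * u ^ p - u ^ p * v ^ p) - a * u ^ p * l - a * v ^ p * l
      - a * (l * w ^ p - w ^ p * l) - a * w ^ p * l \<in> L2"
    by (intro subspace_diff[OF subspace_L2] square comm add u v w pow \<open>l \<in> A\<close>)
  also have "a * w ^ p * w ^ p - a * u ^ p * u ^ p - a * v ^ p * v ^ p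
      - a * (v ^ p * u ^ p - u ^ p * v ^ p) - a * u ^ p * l - a * v ^ p * l
      - a * (l * w ^ p - w ^ p * l) - a * w ^ p * l = of_nat 2 *s (a * u ^ p * v ^ p)"
  proof -
    have "w ^ p = u ^ p + v ^ p + l" by (simp add: l_def)
    then show ?thesis unfolding scale_of_nat by (simp add: algebra_simps mult_2)
  qed
  finally have "inverse (of_nat 2) *s of_nat 2 *s (a * u ^ p * v ^ p) \<in> L2"
    by (rule subspace_scale[OF subspace_L2])
  moreover have "of_nat 2 \<noteq> (0 :: 'k)" using of_nat_neq_0[of 2] p_gt_2 by simp
  ultimately show ?thesis by simp
qed

text \<open>This closure property is what makes the third space collapse to the second.\<close>

lemma L2_mult_power:
  assumes "u \<in> L2" "v \<in> A"
  shows "u * v ^ p \<in> L2"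
proof -
  have "subspace {u. u * v ^ p \<in> L2}"
    using subspace_preimage_mult[OF subspace_L2, of 1 "v ^ p"] by simp
  moreover have "u * v ^ p \<in> L2" if "u \<in> L1 \<union> {a * w ^ p |a w. a \<in> L1 \<and> w \<in> A}" for u
    using that L1_mult_L1 L1_mult_power_mult_power power_in_L1 assms(2) by auto
  ultimately show ?thesis
    using assms(1) unfolding L2_def by (auto elim!: span_induct)
qed

end

section \<open>The free algebra inside noncommutative power series\<close>

text \<open>Admitting all coefficient functions gives a full type with a unit, as
  \<open>ring_1\<close> requires. Products stay finite sums because a word has finitely many
  splittings.\<close>

typedef (overloaded) 'k ncseries = "UNIV :: (nat list \<Rightarrow> 'k::field) set"
  morphisms coeff Ncseries
  by simp

lemma coeff_Ncseries [simp]: "coeff (Ncseries f) = f"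
  by (simp add: Ncseries_inverse)

lemma ncseries_eqI: "(\<And>w. coeff x w = coeff y w) \<Longrightarrow> x = y"
  by (metis coeff_inject ext)

instantiation ncseries :: (field) ring_1
begin

definition "0 = Ncseries (\<lambda>_. 0)"
definition "1 = Ncseries (\<lambda>w. if w = [] then 1 else 0)"
definition "x + y = Ncseries (ncadd (coeff x) (coeff y))"
definition "x * y = Ncseries (ncmul (coeff x) (coeff y))"
definition "- x = Ncseries (\<lambda>w. - coeff x w)"
definition "x - y = Ncseries (\<lambda>w. coeff x w - coeff y w)" for x y :: "'a ncseries"

lemma coeff_0 [simp]: "coeff 0 w = 0"
  and coeff_1: "coeff 1 w = (if w = [] then 1 else 0)"
  and coeff_add [simp]: "coeff (x + y) w = coeff x w + coeff y w"
  and coeff_mult: "coeff (x * y) w = (\<Sum>i\<le>length w. coeff x (take i w) * coeff y (drop i w))"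
  and coeff_uminus [simp]: "coeff (- x) w = - coeff x w"
  and coeff_minus [simp]: "coeff (x - y) w = coeff x w - coeff y w"
  by (simp_all add: zero_ncseries_def one_ncseries_def plus_ncseries_def times_ncseries_def
      uminus_ncseries_def minus_ncseries_def ncadd_def ncmul_def)

instance
proof
  fix x y z :: "'a ncseries"
  show "x * y * z = x * (y * z)"
  proof (rule ncseries_eqI)
    fix w :: "nat list"
    let ?n = "length w"
    \<comment> \<open>The arguments are the lengths of three consecutive factors of
      \<open>w\<close>. Associativity then becomes the exchange of triangular sums known from formal
      power series.\<close>
    let ?f = "\<lambda>i j k. coeff x (take i w) * coeff y (take j (drop i w)) * coeff z (drop (?n - k) w)"
    have "coeff (x * y * z) w = (\<Sum>j=0..?n. \<Sum>i=0..j. ?f i (j - i) (?n - j))"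
      by (auto simp: coeff_mult atMost_atLeast0 sum_distrib_right min.absorb1 min.absorb2
          drop_take intro!: sum.cong)
    also have "\<dots> = (\<Sum>j=0..?n. \<Sum>i=0..?n - j. ?f j i (?n - j - i))"
      by (rule fps_mult_assoc_lemma)
    also have "\<dots> = coeff (x * (y * z)) w"
      by (auto simp: coeff_mult atMost_atLeast0 sum_distrib_left mult.assoc add.commute intro!: sum.cong)
    finally show "coeff (x * y * z) w = coeff (x * (y * z)) w" .
  qed
  show "1 * x = x"
  proof (rule ncseries_eqI)
    fix w :: "nat list"
    have "coeff (1 * x) w = (\<Sum>i\<le>length w. if i = 0 then coeff x w else 0)"
      unfolding coeff_mult coeff_1 by (intro sum.cong) auto
    then show "coeff (1 * x) w = coeff x w" by simp
  qed
  show "x * 1 = x"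
  proof (rule ncseries_eqI)
    fix w :: "nat list"
    have "coeff (x * 1) w = (\<Sum>i\<le>length w. if i = length w then coeff x w else 0)"
      unfolding coeff_mult coeff_1 by (intro sum.cong) auto
    then show "coeff (x * 1) w = coeff x w" by simp
  qed
  show "(x + y) * z = x * z + y * z" "x * (y + z) = x * y + x * z"
    by (auto intro!: ncseries_eqI simp: coeff_mult ring_distribs sum.distrib)
  have "coeff 0 [] \<noteq> coeff (1 :: 'a ncseries) []" by (simp add: coeff_1)
  then show "(0 :: 'a ncseries) \<noteq> 1" by metis
qed (auto intro!: ncseries_eqI)

end

definition scale_ncs :: "'k::field \<Rightarrow> 'k ncseries \<Rightarrow> 'k ncseries" where
  "scale_ncs c x = Ncseries (ncsmult c (coeff x))"

lemma coeff_scale [simp]: "coeff (scale_ncs c x) w = c * coeff x w"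
  by (simp add: scale_ncs_def ncsmult_def)

interpretation ncs: assoc_algebra scale_ncs
  by unfold_locales
    (auto intro!: ncseries_eqI simp: coeff_mult algebra_simps sum_distrib_left)

lemma coeff_sum: "coeff (sum f B) w = (\<Sum>i\<in>B. coeff (f i) w)"
  by (induction B rule: infinite_finite_induct) auto

definition free_ncs :: "'k::field ncseries set" where
  "free_ncs = coeff -` freealg"

lemma free_ncs_iff: "x \<in> free_ncs \<longleftrightarrow> finite {w. coeff x w \<noteq> 0} \<and> coeff x [] = 0"
  by (simp add: free_ncs_def freealg_def)

lemma coeff_image_free_ncs: "coeff ` free_ncs = freealg"
  unfolding free_ncs_def by (auto intro: image_eqI[of _ _ "Ncseries _"])

lemma subspace_free_ncs: "ncs.subspace (free_ncs :: 'k::field ncseries set)"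
proof (rule ncs.subspaceI)
  fix x y :: "'k ncseries" and c
  assume x: "x \<in> free_ncs"
  show "scale_ncs c x \<in> free_ncs"
    using x by (auto simp: free_ncs_iff elim!: finite_subset[rotated])
  assume y: "y \<in> free_ncs"
  have "{w. coeff (x + y) w \<noteq> 0} \<subseteq> {w. coeff x w \<noteq> 0} \<union> {w. coeff y w \<noteq> 0}" by auto
  then show "x + y \<in> free_ncs"
    using x y by (auto simp: free_ncs_iff elim!: finite_subset)
qed (simp add: free_ncs_iff)

lemma mult_free_ncs:
  assumes "x \<in> free_ncs" "y \<in> free_ncs"
  shows "x * y \<in> free_ncs"
proof -
  have "w \<in> (\<lambda>(u, v). u @ v) ` ({w. coeff x w \<noteq> 0} \<times> {w. coeff y w \<noteq> 0})"
    if nz: "coeff (x * y) w \<noteq> 0" for w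
  proof -
    obtain i where "coeff x (take i w) * coeff y (drop i w) \<noteq> 0"
      using nz unfolding coeff_mult by (meson sum.neutral)
    then show ?thesis by (intro image_eqI[of _ _ "(take i w, drop i w)"]) auto
  qed
  then have "{w. coeff (x * y) w \<noteq> 0} \<subseteq> (\<lambda>(u, v). u @ v) ` ({w. coeff x w \<noteq> 0} \<times> {w. coeff y w \<noteq> 0})"
    by blast
  moreover have "finite \<dots>"
    using assms by (simp add: free_ncs_iff)
  ultimately have "finite {w. coeff (x * y) w \<noteq> 0}" by (rule finite_subset)
  then show ?thesis using assms by (simp add: free_ncs_iff coeff_mult)
qed

section \<open>Monomials spanning the free algebra\<close>

definition monomial :: "nat list \<Rightarrow> 'k::field ncseries" where
  "monomial u = Ncseries (\<lambda>w. if w = u then 1 else 0)"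

lemma coeff_monomial: "coeff (monomial u) w = (if w = u then 1 else 0)"
  by (simp add: monomial_def)

lemma monomial_in_free_ncs: "u \<noteq> [] \<Longrightarrow> monomial u \<in> free_ncs"
  by (simp add: free_ncs_iff coeff_monomial)

lemma monomial_mult: "monomial u * monomial v = (monomial (u @ v) :: 'k::field ncseries)"
proof (rule ncseries_eqI)
  fix w
  have "coeff (monomial u * monomial v :: 'k ncseries) w =
      (\<Sum>i\<le>length w. if i = length u \<and> w = u @ v then 1 else 0)"
    unfolding coeff_mult coeff_monomial
  proof (rule sum.cong)
    fix i assume "i \<in> {..length w}"
    then have "take i w = u \<and> drop i w = v \<longleftrightarrow> i = length u \<and> w = u @ v"
      by (auto simp: min.absorb2)
    then show "(if take i w = u then 1 else 0) * (if drop i w = v then 1 else 0) =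
        (if i = length u \<and> w = u @ v then 1 else (0 :: 'k))" by auto
  qed simp
  then show "coeff (monomial u * monomial v) w = coeff (monomial (u @ v) :: 'k ncseries) w"
    by (auto simp: coeff_monomial sum.If_cases)
qed

lemma free_ncs_eq_span: "(free_ncs :: 'k::field ncseries set) = ncs.span (monomial ` (- {[]}))"
proof
  show "ncs.span (monomial ` (- {[]})) \<subseteq> (free_ncs :: 'k ncseries set)"
    by (intro ncs.span_minimal subspace_free_ncs) (auto intro: monomial_in_free_ncs)
next
  show "(free_ncs :: 'k ncseries set) \<subseteq> ncs.span (monomial ` (- {[]}))"
  proof
    fix x :: "'k ncseries"
    assume x: "x \<in> free_ncs"
    have "x = (\<Sum>u\<in>{u. coeff x u \<noteq> 0}. scale_ncs (coeff x u) (monomial u))"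
      using x by (intro ncseries_eqI)
        (simp add: coeff_sum coeff_monomial free_ncs_iff if_distrib[of "\<lambda>z. _ * z"] cong: if_cong)
    moreover have "\<dots> \<in> ncs.span (monomial ` (- {[]}))"
      using x by (intro ncs.span_sum ncs.span_scale ncs.span_base) (auto simp: free_ncs_iff)
    ultimately show "x \<in> ncs.span (monomial ` (- {[]}))" by simp
  qed
qed

lemma free_ncs_induct [consumes 1, case_names zero add scale monomial]:
  assumes "x \<in> free_ncs" "P 0"
    and "\<And>x y. \<lbrakk>x \<in> free_ncs; y \<in> free_ncs; P x; P y\<rbrakk> \<Longrightarrow> P (x + y)"
    and "\<And>c x. \<lbrakk>x \<in> free_ncs; P x\<rbrakk> \<Longrightarrow> P (scale_ncs c x)"
    and "\<And>u. u \<noteq> [] \<Longrightarrow> P (monomial u)"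
  shows "P x"
proof -
  have "ncs.subspace {x \<in> free_ncs. P x}"
    using assms subspace_free_ncs by (auto simp: ncs.subspace_def)
  then have "ncs.span (monomial ` (- {[]})) \<subseteq> {x \<in> free_ncs. P x}"
    using assms by (intro ncs.span_minimal) (auto intro: monomial_in_free_ncs)
  then show ?thesis using assms(1) unfolding free_ncs_eq_span by blast
qed

section \<open>Substitutions as algebra endomorphisms\<close>

definition subst_ncs :: "(nat \<Rightarrow> 'k::field ncseries) \<Rightarrow> 'k ncseries \<Rightarrow> 'k ncseries" where
  "subst_ncs s x = Ncseries (ncsubst (\<lambda>i. coeff (s i)) (coeff x))"

definition word_ncs :: "(nat \<Rightarrow> 'k::field ncseries) \<Rightarrow> nat list \<Rightarrow> 'k ncseries" where
  "word_ncs s w = Ncseries (wordeval (\<lambda>i. coeff (s i)) w)"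

lemma word_ncs_singleton: "word_ncs s [i] = s i"
  by (simp add: word_ncs_def coeff_inverse)

lemma word_ncs_Cons: "w \<noteq> [] \<Longrightarrow> word_ncs s (i # w) = s i * word_ncs s w"
  by (cases w) (auto simp: word_ncs_def times_ncseries_def)

text \<open>Empty words are excluded because \<open>wordeval\<close> sends them to 0 rather than to
  1.\<close>

lemma word_ncs_append:
  "\<lbrakk>u \<noteq> []; v \<noteq> []\<rbrakk> \<Longrightarrow> word_ncs s (u @ v) = word_ncs s u * word_ncs s v"
proof (induction u rule: list_nonempty_induct)
  case (single i)
  then show ?case by (simp add: word_ncs_singleton word_ncs_Cons)
next
  case (cons i u)
  then show ?case by (simp add: word_ncs_Cons mult.assoc)
qed

text \<open>The defining sum runs over the support, which varies with \<open>x\<close>; a common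
  finite superset makes linearity visible.\<close>

lemma subst_ncs_eq_sum:
  assumes "finite B" "{w. coeff x w \<noteq> 0} \<subseteq> B"
  shows "subst_ncs s x = (\<Sum>w\<in>B. scale_ncs (coeff x w) (word_ncs s w))"
  using assms by (intro ncseries_eqI)
    (auto simp: subst_ncs_def ncsubst_def word_ncs_def coeff_sum intro!: sum.mono_neutral_left)

lemma subst_ncs_monomial: "subst_ncs s (monomial u) = word_ncs s u"
  by (subst subst_ncs_eq_sum[of "{u}"]) (auto simp: coeff_monomial)

lemma subst_ncs_0: "subst_ncs s 0 = 0"
  by (subst subst_ncs_eq_sum[of "{}"]) auto

lemma subst_ncs_add:
  assumes "x \<in> free_ncs" "y \<in> free_ncs"
  shows "subst_ncs s (x + y) = subst_ncs s x + subst_ncs s y"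
proof -
  let ?B = "{w. coeff x w \<noteq> 0} \<union> {w. coeff y w \<noteq> 0}"
  have "finite ?B" using assms by (simp add: free_ncs_iff)
  moreover have "{w. coeff (x + y) w \<noteq> 0} \<subseteq> ?B" by auto
  ultimately show ?thesis
    by (simp add: subst_ncs_eq_sum[of ?B] ncs.scale_left_distrib sum.distrib)
qed

lemma subst_ncs_scale:
  assumes "x \<in> free_ncs"
  shows "subst_ncs s (scale_ncs c x) = scale_ncs c (subst_ncs s x)"
proof -
  let ?B = "{w. coeff x w \<noteq> 0}"
  have "finite ?B" using assms by (simp add: free_ncs_iff)
  then show ?thesis
    by (subst (1 2) subst_ncs_eq_sum[of ?B]) (auto simp: ncs.scale_sum_right)
qed

text \<open>Both sides are bilinear, so monomials suffice, where the product is concatenation of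
  words.\<close>

lemma subst_ncs_mult:
  assumes "x \<in> free_ncs" "y \<in> free_ncs"
  shows "subst_ncs s (x * y) = subst_ncs s x * subst_ncs s y"
  using assms(1)
proof (induction rule: free_ncs_induct)
  case (monomial u)
  show ?case using assms(2)
  proof (induction rule: free_ncs_induct)
    case (monomial v)
    then show ?case using \<open>u \<noteq> []\<close>
      by (simp add: monomial_mult subst_ncs_monomial word_ncs_append)
  qed (use \<open>u \<noteq> []\<close> in \<open>simp_all add: subst_ncs_0 subst_ncs_add subst_ncs_scale ring_distribs
      mult_free_ncs monomial_in_free_ncs\<close>)
qed (simp_all add: subst_ncs_0 subst_ncs_add subst_ncs_scale ring_distribs mult_free_ncs assms(2))

lemma power_free_ncs: "\<lbrakk>x \<in> free_ncs; 0 < n\<rbrakk> \<Longrightarrow> x ^ n \<in> free_ncs"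
proof (induction n)
  case (Suc n)
  then show ?case by (cases "n = 0") (auto intro: mult_free_ncs)
qed simp

lemma subst_ncs_power:
  "\<lbrakk>x \<in> free_ncs; 0 < n\<rbrakk> \<Longrightarrow> subst_ncs s (x ^ n) = subst_ncs s x ^ n"
proof (induction n)
  case (Suc n)
  then show ?case by (cases "n = 0") (auto simp: subst_ncs_mult power_free_ncs)
qed simp

lemma subst_ncs_in_free_ncs:
  assumes s: "\<And>i. s i \<in> free_ncs" and "x \<in> free_ncs"
  shows "subst_ncs s x \<in> free_ncs"
  using assms(2)
proof (induction rule: free_ncs_induct)
  case (monomial u)
  then have "word_ncs s u \<in> free_ncs"
    by (induction u rule: list_nonempty_induct)
      (auto simp: word_ncs_singleton word_ncs_Cons s intro: mult_free_ncs)
  then show ?case by (simp add: subst_ncs_monomial)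
qed (simp_all add: subst_ncs_0 subst_ncs_add subst_ncs_scale ncs.subspace_0 ncs.subspace_add
    ncs.subspace_scale subspace_free_ncs)

lemma coeff_power: "0 < n \<Longrightarrow> coeff (x ^ n) = ncpow (coeff x) n"
proof -
  \<comment> \<open>The exponent of \<open>ncpow'\<close> is shifted by one, its value at 0 being
    the first power.\<close>
  have "coeff (x ^ Suc m) = ncpow' (coeff x) m" for m
  proof (induction m)
    case (Suc m)
    have "coeff (x ^ Suc (Suc m)) = ncmul (coeff (x ^ Suc m)) (coeff x)"
      by (simp only: power_Suc2[of x "Suc m"] times_ncseries_def coeff_Ncseries)
    then show ?case by (simp only: Suc ncpow'.simps)
  qed simp
  then show "0 < n \<Longrightarrow> ?thesis" by (cases n) (simp_all only: ncpow_def diff_Suc_1)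
qed

section \<open>T-spaces\<close>

lemma Tspace_coeff_image_iff:
  "Tspace (coeff ` V) \<longleftrightarrow> ncs.subspace V \<and> V \<subseteq> free_ncs \<and>
     (\<forall>s. (\<forall>i. s i \<in> free_ncs) \<longrightarrow> (\<forall>x\<in>V. subst_ncs s x \<in> V))"
proof -
  have mem: "f \<in> coeff ` V \<longleftrightarrow> Ncseries f \<in> V" for f
    by (metis coeff_Ncseries coeff_inverse image_iff)
  have endo: "(\<forall>s. is_endo s \<longrightarrow> Q s) \<longleftrightarrow>
      (\<forall>s. (\<forall>i. s i \<in> free_ncs) \<longrightarrow> Q (\<lambda>i. coeff (s i)))" for Q :: "(nat \<Rightarrow> 'a ncpoly) \<Rightarrow> bool"
  proof (intro iffI allI impI)
    fix s :: "nat \<Rightarrow> 'a ncpoly"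
    assume "\<forall>s. (\<forall>i. s i \<in> free_ncs) \<longrightarrow> Q (\<lambda>i. coeff (s i))" "is_endo s"
    from this(1)[rule_format, of "\<lambda>i. Ncseries (s i)"] this(2) show "Q s"
      by (simp add: is_endo_def free_ncs_def)
  qed (simp add: is_endo_def free_ncs_def)
  have "coeff ` V \<subseteq> freealg \<longleftrightarrow> V \<subseteq> free_ncs"
    by (auto simp: free_ncs_def)
  then show ?thesis
    unfolding Tspace_def ncs.subspace_def endo
    by (auto simp: mem zero_ncseries_def plus_ncseries_def scale_ncs_def subst_ncs_def)
qed

lemma Tspan_minimal: "\<lbrakk>Tspace V; S \<subseteq> V\<rbrakk> \<Longrightarrow> Tspan S \<subseteq> V"
  by (auto simp: Tspan_def)

lemma Tspan_superset: "S \<subseteq> Tspan S"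
  by (auto simp: Tspan_def)

text \<open>Substitution is linear, so invariance needs checking only on the spanning set.\<close>

lemma Tspace_coeff_span:
  assumes "S \<subseteq> free_ncs"
    and "\<And>s x. \<lbrakk>\<And>i. s i \<in> free_ncs; x \<in> S\<rbrakk> \<Longrightarrow> subst_ncs s x \<in> ncs.span S"
  shows "Tspace (coeff ` ncs.span S)"
proof -
  have sub: "ncs.span S \<subseteq> free_ncs"
    by (intro ncs.span_minimal subspace_free_ncs assms(1))
  have "subst_ncs s x \<in> ncs.span S" if s: "\<And>i. s i \<in> free_ncs" and x: "x \<in> ncs.span S" for s x
  proof -
    have "ncs.subspace {x \<in> free_ncs. subst_ncs s x \<in> ncs.span S}"
      using subspace_free_ncs ncs.subspace_span[of S]
      by (auto simp: ncs.subspace_def subst_ncs_0 subst_ncs_add subst_ncs_scale)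
    then have "ncs.span S \<subseteq> {x \<in> free_ncs. subst_ncs s x \<in> ncs.span S}"
      using assms s by (intro ncs.span_minimal) auto
    then show ?thesis using x by auto
  qed
  then show ?thesis
    using sub by (simp add: Tspace_coeff_image_iff ncs.subspace_span)
qed

text \<open>Here \<open>G\<close> generates under substitutions and linear combinations,
  \<open>S\<close> under linear combinations alone; the last assumption says that substitutions
  reach \<open>S\<close> from \<open>G\<close>.\<close>

lemma Tspan_coeff_image_eq:
  assumes "Tspace (coeff ` ncs.span S)" "G \<subseteq> ncs.span S"
    and "\<And>V. \<lbrakk>Tspace (coeff ` V); G \<subseteq> V\<rbrakk> \<Longrightarrow> S \<subseteq> V"
  shows "Tspan (coeff ` G) = coeff ` ncs.span S"
proof
  show "Tspan (coeff ` G) \<subseteq> coeff ` ncs.span S"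
    using assms(1,2) by (intro Tspan_minimal) auto
  have "coeff ` ncs.span S \<subseteq> W" if W: "Tspace W" "coeff ` G \<subseteq> W" for W
  proof -
    have "W = coeff ` (coeff -` W)"
      by (auto intro: image_eqI[of _ _ "Ncseries _"])
    with W(1) have T: "Tspace (coeff ` (coeff -` W))" by simp
    moreover have "G \<subseteq> coeff -` W" using W(2) by blast
    ultimately have "S \<subseteq> coeff -` W" by (rule assms(3))
    then have "ncs.span S \<subseteq> coeff -` W"
      using T[unfolded Tspace_coeff_image_iff] by (intro ncs.span_minimal) simp_all
    then show ?thesis by blast
  qed
  then show "coeff ` ncs.span S \<subseteq> Tspan (coeff ` G)"
    unfolding Tspan_def by blast
qed

section \<open>The first three T-spaces of the free algebra\<close>

locale free_power_spaces =
  power_spaces "scale_ncs :: 'k::field \<Rightarrow> 'k ncseries \<Rightarrow> 'k ncseries" free_ncs p for p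
begin

lemma Tspace_L1: "Tspace (coeff ` L1)"
  unfolding L1_def
proof (rule Tspace_coeff_span)
  show "(\<lambda>v. v ^ p) ` (free_ncs :: 'k ncseries set) \<subseteq> free_ncs"
    using p_gt_2 by (auto intro: power_A)
  show "subst_ncs s x \<in> ncs.span ((\<lambda>v. v ^ p) ` (free_ncs :: 'k ncseries set))"
    if "\<And>i. s i \<in> free_ncs" "x \<in> (\<lambda>v. v ^ p) ` (free_ncs :: 'k ncseries set)" for s x
    using that p_gt_2 by (auto simp: subst_ncs_power intro!: ncs.span_base subst_ncs_in_free_ncs)
qed

lemma Tspace_L2: "Tspace (coeff ` L2)"
  unfolding L2_def
proof (rule Tspace_coeff_span)
  let ?S = "L1 \<union> {u * v ^ p |u v. u \<in> L1 \<and> v \<in> free_ncs}"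
  show "?S \<subseteq> free_ncs"
    using L1_subset_A p_gt_2 by (auto intro!: mult_A power_A)
  show "subst_ncs s x \<in> ncs.span ?S" if s: "\<And>i. s i \<in> free_ncs" and x: "x \<in> ?S" for s x
  proof (rule ncs.span_base)
    have *: "subst_ncs s u \<in> L1" if "u \<in> L1" for u
      using Tspace_L1 s that by (simp add: Tspace_coeff_image_iff)
    have "subst_ncs s (u * v ^ p) = subst_ncs s u * subst_ncs s v ^ p"
      if "u \<in> L1" "v \<in> free_ncs" for u v
      using that p_gt_2 L1_subset_A by (auto simp: subst_ncs_mult subst_ncs_power power_A)
    then show "subst_ncs s x \<in> ?S"
      using x * subst_ncs_in_free_ncs[OF s] by fastforce
  qed
qed

lemma Lsp_1: "Lsp p 1 = coeff ` L1"
proof -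
  have "Tspan (coeff ` {monomial [1] ^ p}) = coeff ` L1"
    unfolding L1_def
  proof (rule Tspan_coeff_image_eq)
    show "Tspace (coeff ` ncs.span ((\<lambda>v. v ^ p) ` (free_ncs :: 'k ncseries set)))"
      using Tspace_L1 by (simp add: L1_def)
    show "{monomial [1] ^ p} \<subseteq> ncs.span ((\<lambda>v. v ^ p) ` (free_ncs :: 'k ncseries set))"
      by (auto intro!: ncs.span_base monomial_in_free_ncs)
    show "(\<lambda>v. v ^ p) ` (free_ncs :: 'k ncseries set) \<subseteq> V" if V: "Tspace (coeff ` V)" "{monomial [1] ^ p} \<subseteq> V" for V
    proof clarify
      fix v :: "'k ncseries"
      assume v: "v \<in> free_ncs"
      \<comment> \<open>Sending every variable to \<open>v\<close> turns the single generator into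
        an arbitrary \<open>p\<close>-th power.\<close>
      have "subst_ncs (\<lambda>_. v) (monomial [1] ^ p) \<in> V"
        using V v by (auto simp: Tspace_coeff_image_iff)
      also have "subst_ncs (\<lambda>_. v) (monomial [1] ^ p) = v ^ p"
        using p_gt_2
        by (simp add: subst_ncs_power monomial_in_free_ncs subst_ncs_monomial word_ncs_singleton)
      finally show "v ^ p \<in> V" .
    qed
  qed
  moreover have "coeff ` {monomial [1] ^ p} = {ncpow (ncvar 1 :: 'k ncpoly) p}"
    using p_gt_2 by (simp add: coeff_power monomial_def ncvar_def)
  ultimately show ?thesis by simp
qed

lemma ncmul_ncpow_image:
  "{ncmul u (ncpow v p) |u v. u \<in> coeff ` U \<and> v \<in> freealg} =
    coeff ` {u * v ^ p |u v. u \<in> U \<and> v \<in> free_ncs}"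
proof -
  have "{ncmul u (ncpow v p) |u v. u \<in> coeff ` U \<and> v \<in> freealg} =
      {ncmul (coeff u) (ncpow (coeff v) p) |u v. u \<in> U \<and> v \<in> free_ncs}"
    unfolding coeff_image_free_ncs[symmetric] by blast
  also have "\<dots> = {coeff (u * v ^ p) |u v. u \<in> U \<and> v \<in> free_ncs}"
    using p_gt_2 by (simp add: times_ncseries_def coeff_power)
  also have "\<dots> = coeff ` {u * v ^ p |u v. u \<in> U \<and> v \<in> free_ncs}" by blast
  finally show ?thesis .
qed

lemma Lsp_2: "Lsp p 2 = coeff ` L2"
proof -
  let ?S = "L1 \<union> {u * v ^ p |u v. u \<in> L1 \<and> v \<in> free_ncs}"
  have "Tspan (coeff ` ?S) = coeff ` L2"
    unfolding L2_def
    using Tspace_L2 by (intro Tspan_coeff_image_eq) (auto simp: L2_def intro: ncs.span_base)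
  then show ?thesis
    using Lsp_1 ncmul_ncpow_image[of L1] by (simp add: numeral_2_eq_2 image_Un)
qed

text \<open>By \<open>L2_mult_power\<close> the generators of the third space lie in the T-space
  \<open>L2\<close>, which they include.\<close>

lemma Lsp_3: "Lsp p 3 = coeff ` L2"
proof -
  let ?S = "coeff ` (L2 \<union> {u * v ^ p |u v. u \<in> L2 \<and> v \<in> free_ncs})"
  have "Tspan ?S = coeff ` L2"
  proof
    show "Tspan ?S \<subseteq> coeff ` L2"
      using L2_mult_power by (intro Tspan_minimal Tspace_L2) auto
    show "coeff ` L2 \<subseteq> Tspan ?S"
      using Tspan_superset[of ?S] by blast
  qed
  then show ?thesis
    using Lsp_2 ncmul_ncpow_image[of L2] by (simp add: numeral_2_eq_2 numeral_3_eq_3 image_Un)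
qed

end

theorem theorem3p1:
  assumes "infinite (UNIV :: 'k::field set)"
    and "CHAR('k) > 2"
  shows "(Lsp CHAR('k) 2 :: 'k ncpoly set) = Lsp CHAR('k) 3"
proof -
  have "of_nat i \<noteq> (0 :: 'k)" if "0 < i" "i < CHAR('k)" for i
    using that by (auto simp: of_nat_eq_0_iff_char_dvd dest: dvd_imp_le)
  then interpret free_power_spaces "CHAR('k)"
    using assms by unfold_locales (auto simp: subspace_free_ncs mult_free_ncs)
  show ?thesis by (simp only: Lsp_2 Lsp_3)
qed

end
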